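(* Let $\mathcal{H}$ be a real or complex Hilbert space and let $\mathcal{W}=\{(W_i,v_i)\}_{i\in I}$ be a Riesz decomposition of $\mathcal{H}$. Then the excess of $\mathcal{W}$ is equal to zero: $e(\mathcal{W})=0$.
   Context: A fusion frame for $\mathcal{H}$ is a countable family $\{(W_i,v_i)\}_{i\in I}$ of closed subspaces $W_i\subseteq\mathcal{H}$ with weights $v_i>0$ for which there are constants $0<A\le B<\infty$ with $A\|x\|^2\le\sum_{i\in I}v_i^2\|P_{W_i}(x)\|^2\le B\|x\|^2$ for all $x\in\mathcal{H}$, where $P_{W_i}$ is the orthogonal projection onto $W_i$. A fusion frame $\{(W_i,v_i)\}_{i\in I}$ is a Riesz decomposition of $\mathcal{H}$ if every $f\in\mathcal{H}$ has a unique representation $f=\sum_{i\in I}f_i$ with $f_i\in W_i$. The synthesis operator is $T_{\mathcal{W}}:\big(\sum_{i\in I}\oplus W_i\big)_{\ell_2}\to\mathcal{H}$, $T_{\mathcal{W}}(\{f_i\}_{i\in I})=\sum_{i\in I}v_if_i$, where $\big(\sum_{i\in I}\oplus W_i\big)_{\ell_2}$ is the Hilbert space of families $\{f_i\}_{i\in I}$ with $f_i\in W_i$ and $\sum_i\|f_i\|^2<\infty$. The excess of $\mathcal{W}$ is $e(\mathcal{W})=\dim\ker T_{\mathcal{W}}$. *)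

theory Defs
  imports
    "HOL-Analysis.Analysis"
    "HOL-Library.Function_Algebras"
    "HOL-Library.Extended_Nat"
begin

text \<open>
  The scalar fields. The axioms admit exactly the real and the complex field, with their absolute
  value and conjugation: see \<open>rc_field_real_or_complex\<close>.
\<close>

class rc_field = real_normed_field +
  fixes rc_cnj :: "'a \<Rightarrow> 'a"
  assumes rc_cnj_add: "rc_cnj (a + b) = rc_cnj a + rc_cnj b"
    and rc_cnj_mult: "rc_cnj (a * b) = rc_cnj a * rc_cnj b"
    and rc_cnj_scaleR_one: "rc_cnj (r *\<^sub>R 1) = r *\<^sub>R 1"
    and mult_rc_cnj_scaleR: "a * rc_cnj a = (norm a)\<^sup>2 *\<^sub>R 1"

lemma rc_cnj_of_real: "rc_cnj (of_real r :: 'k::rc_field) = of_real r"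
  by (simp add: of_real_def rc_cnj_scaleR_one)

lemma mult_rc_cnj: "(a :: 'k::rc_field) * rc_cnj a = of_real ((norm a)\<^sup>2)"
  by (simp add: of_real_def mult_rc_cnj_scaleR)

instantiation real :: rc_field
begin
definition rc_cnj_real :: "real \<Rightarrow> real" where "rc_cnj_real a = a"
instance by standard (auto simp: rc_cnj_real_def power2_eq_square)
end

instantiation complex :: rc_field
begin
definition rc_cnj_complex :: "complex \<Rightarrow> complex" where "rc_cnj_complex a = cnj a"
instance
proof
  fix a :: complex
  show "a * rc_cnj a = (norm a)\<^sup>2 *\<^sub>R 1"
    unfolding rc_cnj_complex_def scaleR_conv_of_real complex_norm_square by simp
qed (simp_all add: rc_cnj_complex_def)
end

lemma rc_field_add_cnj_Reals: "(a :: 'k::rc_field) + rc_cnj a \<in> \<real>"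
proof -
  have "(a + 1) * rc_cnj (a + 1) = a * rc_cnj a + (a + rc_cnj a) + 1"
    using rc_cnj_of_real[of 1, where 'k = 'k] by (simp add: rc_cnj_add algebra_simps)
  then have "a + rc_cnj a = of_real ((norm (a + 1))\<^sup>2 - (norm a)\<^sup>2 - 1)"
    unfolding mult_rc_cnj by (simp add: algebra_simps)
  then show ?thesis by (metis Reals_of_real)
qed

lemma rc_field_real_or_complex:
  "(\<forall>z :: 'k::rc_field. z \<in> \<real>) \<or>
   (\<exists>j :: 'k. j * j = -1 \<and> rc_cnj j = - j \<and> (\<forall>z. \<exists>a b. z = of_real a + of_real b * j))"
proof (cases "\<forall>z :: 'k. z \<in> \<real>")
  case False
  have split: "\<exists>a w. z = of_real a + w \<and> rc_cnj w = - w" for z :: 'k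
  proof -
    obtain t where t: "z + rc_cnj z = of_real t"
      using rc_field_add_cnj_Reals[of z] by (auto simp: Reals_def)
    then have c: "rc_cnj z = of_real t - z" by (simp add: algebra_simps)
    have m: "rc_cnj (- of_real (t / 2) :: 'k) = - of_real (t / 2)"
      using rc_cnj_of_real[of "- (t / 2)", where 'k = 'k] by simp
    have "rc_cnj (z - of_real (t / 2)) = of_real t - z - of_real (t / 2)"
      using rc_cnj_add[of z "- of_real (t / 2)"] m c by simp
    also have "\<dots> = - (z - of_real (t / 2))"
      by (simp add: field_simps)
    finally show ?thesis
      by (intro exI[of _ "t / 2"] exI[of _ "z - of_real (t / 2)"]) simp
  qed
  from False obtain z0 :: 'k where z0: "z0 \<notin> \<real>" by blast
  obtain a0 w where w: "z0 = of_real a0 + w" "rc_cnj w = - w" using split by blast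
  have w0: "w \<noteq> 0" using z0 w by auto
  define j where "j = of_real (1 / norm w) * w"
  have cj: "rc_cnj j = - j"
    unfolding j_def rc_cnj_mult rc_cnj_of_real w by simp
  have nj: "norm j = 1" using w0 by (simp add: j_def norm_divide)
  have jj: "j * j = -1"
  proof -
    have "- (j * j) = 1" using mult_rc_cnj[of j] cj nj by simp
    then show ?thesis by (metis minus_minus)
  qed
  have "\<exists>a b. z = of_real a + of_real b * j" for z :: 'k
  proof -
    obtain a u where u: "z = of_real a + u" "rc_cnj u = - u" using split by blast
    have "rc_cnj (u * j) = u * j" using u cj by (simp add: rc_cnj_mult)
    then have "u * j + u * j \<in> \<real>"
      using rc_field_add_cnj_Reals[of "u * j"] by argo
    then obtain t where t: "u * j + u * j = of_real t"
      by (rule Reals_cases)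
    have uj: "u * j = of_real (t / 2)"
      using t by (simp add: field_simps flip: mult_2)
    have "u = - (u * j * j)" using jj by (simp add: mult.assoc)
    also have "\<dots> = of_real (- (t / 2)) * j" unfolding uj by simp
    finally have "z = of_real a + of_real (- (t / 2)) * j" using u(1) by argo
    then show ?thesis by blast
  qed
  then have "\<exists>j :: 'k. j * j = -1 \<and> rc_cnj j = - j \<and> (\<forall>z. \<exists>a b. z = of_real a + of_real b * j)"
    using cj jj by (intro exI[of _ j]) simp
  then show ?thesis by (rule disjI2)
qed simp


text \<open>
  A Hilbert space over \<open>'k\<close> on a whole type \<open>'h\<close>; sort \<open>banach\<close> supplies the norm, its
  topology and completeness. The inner product is linear in its first argument.
\<close>

locale hilbert_space = vector_space scale
  for scale :: "'k::rc_field \<Rightarrow> 'h::banach \<Rightarrow> 'h" +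
  fixes ip :: "'h \<Rightarrow> 'h \<Rightarrow> 'k"
  assumes scale_of_real: "scale (of_real r) x = r *\<^sub>R x"
    and ip_add_left: "ip (x + y) z = ip x z + ip y z"
    and ip_scale_left: "ip (scale c x) y = c * ip x y"
    and ip_commute: "ip y x = rc_cnj (ip x y)"
    and ip_self: "ip x x = of_real ((norm x)\<^sup>2)"

lemma hilbert_space_real_inner:
  "hilbert_space (*\<^sub>R) (inner :: 'h::{real_inner, banach} \<Rightarrow> 'h \<Rightarrow> real)"
  by unfold_locales
    (auto simp: inner_add_left inner_commute rc_cnj_real_def power2_norm_eq_inner algebra_simps)

lemma hilbert_space_complex: "hilbert_space (*) (\<lambda>x y :: complex. x * cnj y)"
proof unfold_locales
  fix x :: complex
  show "x * cnj x = of_real ((norm x)\<^sup>2)"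
    by (rule complex_norm_square[symmetric])
qed (simp_all add: rc_cnj_complex_def scaleR_conv_of_real distrib_right distrib_left mult.commute)

text \<open>
  The library's \<open>vector_space.dim\<close> takes values in \<open>nat\<close> and is 0 on spaces with
  infinite bases, which \<open>edim\<close> sends to \<open>\<infinity>\<close> instead.
\<close>

definition (in vector_space) edim :: "'b set \<Rightarrow> enat" where
  "edim V = (if \<exists>B. finite B \<and> V \<subseteq> span B then enat (dim V) else \<infinity>)"

context hilbert_space
begin

definition orth_proj :: "'h set \<Rightarrow> 'h \<Rightarrow> 'h" where
  "orth_proj W x = (THE p. p \<in> W \<and> (\<forall>w\<in>W. ip (x - p) w = 0))"

definition fusion_frame :: "'i set \<Rightarrow> ('i \<Rightarrow> 'h set) \<Rightarrow> ('i \<Rightarrow> real) \<Rightarrow> bool" where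
  "fusion_frame I W v \<longleftrightarrow>
     countable I \<and>
     (\<forall>i\<in>I. subspace (W i) \<and> closed (W i) \<and> v i > 0) \<and>
     (\<exists>A B. 0 < A \<and> A \<le> B \<and>
       (\<forall>x. (\<lambda>i. (v i)\<^sup>2 * (norm (orth_proj (W i) x))\<^sup>2) summable_on I \<and>
            A * (norm x)\<^sup>2 \<le> (\<Sum>\<^sub>\<infinity>i\<in>I. (v i)\<^sup>2 * (norm (orth_proj (W i) x))\<^sup>2) \<and>
            (\<Sum>\<^sub>\<infinity>i\<in>I. (v i)\<^sup>2 * (norm (orth_proj (W i) x))\<^sup>2) \<le> B * (norm x)\<^sup>2))"

text \<open>
  A family indexed by \<open>I\<close> is a function on \<open>'i\<close> that vanishes outside \<open>I\<close>, so that
  distinct functions are distinct families.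
\<close>

definition families :: "'i set \<Rightarrow> ('i \<Rightarrow> 'h set) \<Rightarrow> ('i \<Rightarrow> 'h) set" where
  "families I W = {f. (\<forall>i\<in>I. f i \<in> W i) \<and> (\<forall>i. i \<notin> I \<longrightarrow> f i = 0)}"

text \<open>
  \<open>I\<close> carries no order, so the series in a representation converges unconditionally. For a
  fusion frame, convergence along any fixed enumeration of \<open>I\<close> gives the same notion.
\<close>

definition riesz_decomposition :: "'i set \<Rightarrow> ('i \<Rightarrow> 'h set) \<Rightarrow> ('i \<Rightarrow> real) \<Rightarrow> bool" where
  "riesz_decomposition I W v \<longleftrightarrow>
     fusion_frame I W v \<and> (\<forall>x. \<exists>!f. f \<in> families I W \<and> (f has_sum x) I)"

definition l2_sum :: "'i set \<Rightarrow> ('i \<Rightarrow> 'h set) \<Rightarrow> ('i \<Rightarrow> 'h) set" where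
  "l2_sum I W = {f \<in> families I W. (\<lambda>i. (norm (f i))\<^sup>2) summable_on I}"

definition synthesis :: "'i set \<Rightarrow> ('i \<Rightarrow> real) \<Rightarrow> ('i \<Rightarrow> 'h) \<Rightarrow> 'h" where
  "synthesis I v f = (\<Sum>\<^sub>\<infinity>i\<in>I. v i *\<^sub>R f i)"

definition synthesis_kernel ::
    "'i set \<Rightarrow> ('i \<Rightarrow> 'h set) \<Rightarrow> ('i \<Rightarrow> real) \<Rightarrow> ('i \<Rightarrow> 'h) set" where
  "synthesis_kernel I W v = {f \<in> l2_sum I W. synthesis I v f = 0}"

lemma vector_space_families: "vector_space (\<lambda>c (f :: 'i \<Rightarrow> 'h) i. scale c (f i))"
  by unfold_locales (auto simp: fun_eq_iff scale_right_distrib scale_left_distrib)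

definition excess :: "'i set \<Rightarrow> ('i \<Rightarrow> 'h set) \<Rightarrow> ('i \<Rightarrow> real) \<Rightarrow> enat" where
  "excess I W v = vector_space.edim (\<lambda>c (f :: 'i \<Rightarrow> 'h) i. scale c (f i)) (synthesis_kernel I W v)"

end

end

theory Submission
  imports Defs
begin

text \<open>
  For \<open>f\<close> in the domain of the synthesis operator and finite \<open>F \<subseteq> I\<close>, put
  \<open>y = (\<Sum>i\<in>F. v\<^sub>i f\<^sub>i)\<close>. Then \<open>\<parallel>y\<parallel>\<^sup>2 = \<Sum>i\<in>F. \<langle>f\<^sub>i, v\<^sub>i P\<^sub>i y\<rangle>\<close>, so Cauchy-Schwarz and the upper frame
  bound give \<open>\<parallel>y\<parallel>\<^sup>2 \<le> B \<Sum>i\<in>F. \<parallel>f\<^sub>i\<parallel>\<^sup>2\<close>. Hence the synthesis series converges unconditionally; if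
  its sum is \<open>0\<close>, then \<open>(v\<^sub>i f\<^sub>i)\<close> and the zero family both represent \<open>0\<close>, and uniqueness of
  representations forces \<open>f = 0\<close>.
\<close>

section \<open>Unconditional summability from a square bound\<close>

text \<open>Applied to \<open>G - F\<close>, the bound makes the tails of \<open>f\<close> small
  whenever those of \<open>g\<close> are. The net of finite partial sums is therefore Cauchy and
  converges by completeness; absolute convergence is not claimed.\<close>

lemma summable_on_norm_sum_square_le:
  fixes f :: "'i \<Rightarrow> 'h::banach" and g :: "'i \<Rightarrow> real"
  assumes g: "g summable_on A"
    and le: "\<And>F. finite F \<Longrightarrow> F \<subseteq> A \<Longrightarrow> (norm (sum f F))\<^sup>2 \<le> sum g F"
  shows "f summable_on A"
proof -
  have g_nonneg: "0 \<le> g i" if "i \<in> A" for i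
    using le[of "{i}"] that by simp (meson order_trans zero_le_power2)
  have "cauchy_filter (filtermap (sum f) (finite_subsets_at_top A))"
    unfolding cauchy_filter_metric_filtermap
  proof (intro allI impI)
    fix e :: real
    assume "e > 0"
    \<comment> \<open>The bound controls squares: tails of \<open>g\<close> below \<delta> give
      tails of \<open>f\<close> below \<open>e / 4\<close>, and two of these add up to
      \<open>e / 2 < e\<close>.\<close>
    define \<delta> where "\<delta> = (e / 4)\<^sup>2"
    have "\<delta> > 0" using \<open>e > 0\<close> by (simp add: \<delta>_def)
    obtain F where F: "finite F" "F \<subseteq> A" "dist (sum g F) (infsum g A) \<le> \<delta>"
      using has_sum_finite_approximation[OF has_sum_infsum[OF g] \<open>\<delta> > 0\<close>] by blast
    have close: "dist (sum f G) (sum f F) \<le> e / 4" if G: "finite G" "F \<subseteq> G" "G \<subseteq> A" for G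
    proof -
      have "(norm (sum f (G - F)))\<^sup>2 \<le> sum g (G - F)"
        using G le by blast
      also have "\<dots> = sum g G - sum g F"
        using G by (simp add: sum_diff)
      also have "sum g G \<le> infsum g A"
        using G g g_nonneg by (intro finite_sum_le_infsum) auto
      also have "infsum g A - sum g F \<le> \<delta>"
        using F(3) by (simp add: dist_real_def)
      finally have "norm (sum f (G - F)) \<le> e / 4"
        using \<open>e > 0\<close> by (simp add: \<delta>_def power2_le_iff_abs_le)
      then show ?thesis
        using G by (simp add: sum_diff dist_norm)
    qed
    show "\<exists>P. eventually P (finite_subsets_at_top A) \<and>
        (\<forall>G H. P G \<and> P H \<longrightarrow> dist (sum f G) (sum f H) < e)"
    proof (intro exI conjI allI impI)
      show "\<forall>\<^sub>F G in finite_subsets_at_top A. finite G \<and> F \<subseteq> G \<and> G \<subseteq> A"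
        using F by (auto simp: eventually_finite_subsets_at_top)
      fix G H
      assume "(finite G \<and> F \<subseteq> G \<and> G \<subseteq> A) \<and> (finite H \<and> F \<subseteq> H \<and> H \<subseteq> A)"
      then have "dist (sum f G) (sum f F) \<le> e / 4" "dist (sum f H) (sum f F) \<le> e / 4"
        using close by auto
      then show "dist (sum f G) (sum f H) < e"
        using dist_triangle2[of "sum f G" "sum f H" "sum f F"] \<open>e > 0\<close> by linarith
    qed
  qed
  then obtain x where "(sum f \<longlongrightarrow> x) (finite_subsets_at_top A)"
    using complete_uniform[where S=UNIV] complete_UNIV_cuspace
    by (force simp add: filterlim_def)
  then show ?thesis
    unfolding summable_on_def has_sum_def by blast
qed

section \<open>Dimension of the zero space\<close>

lemma (in vector_space) edim_zero: "edim {0} = 0"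
proof -
  have "dim {0} = 0"
    by (rule dim_unique[of "{}"]) (auto simp: independent_empty span_zero)
  \<comment> \<open>This selects the finite branch of \<open>edim\<close>.\<close>
  moreover have "\<exists>B. finite B \<and> {0} \<subseteq> span B"
    by (intro exI[of _ "{}"]) simp
  ultimately show ?thesis
    by (simp add: edim_def zero_enat_def)
qed

section \<open>Inner product calculus and Cauchy-Schwarz\<close>

context hilbert_space
begin

lemma ip_add_right: "ip z (x + y) = ip z x + ip z y"
  by (metis ip_add_left ip_commute rc_cnj_add)

lemma ip_scale_right: "ip x (scale c y) = rc_cnj c * ip x y"
  by (metis ip_scale_left ip_commute rc_cnj_mult)

lemma ip_minus_left: "ip (- x) y = - ip x y"
  \<comment> \<open>The instance at \<open>0 + 0\<close> yields \<open>ip 0 y = 0\<close>.\<close>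
  using ip_add_left[of x "- x" y] ip_add_left[of 0 0 y]
  by (simp add: eq_neg_iff_add_eq_0 add.commute)

lemma ip_minus_right: "ip x (- y) = - ip x y"
  using ip_add_right[of x y "- y"] ip_add_right[of x 0 0]
  by (simp add: eq_neg_iff_add_eq_0 add.commute)

lemma ip_diff_left: "ip (x - y) z = ip x z - ip y z"
  using ip_add_left[of x "- y" z] by (simp add: ip_minus_left)

lemma ip_diff_right: "ip z (x - y) = ip z x - ip z y"
  using ip_add_right[of z x "- y"] by (simp add: ip_minus_right)

lemma ip_scaleR_left: "ip (r *\<^sub>R x) y = of_real r * ip x y"
  by (metis ip_scale_left scale_of_real)

lemma ip_sum_left: "ip (sum f F) y = (\<Sum>i\<in>F. ip (f i) y)"
proof (induction F rule: infinite_finite_induct)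
  case (insert i F)
  then show ?case by (simp add: ip_add_left)
qed (use ip_diff_left[of 0 0 y] in simp_all)

text \<open>Embedded in \<open>'k\<close>, both squared norms equal the product of
  \<open>ip x y\<close> and its conjugate \<open>ip y x\<close>.\<close>

lemma norm_ip_commute: "norm (ip x y) = norm (ip y x)"
proof -
  have "of_real ((norm (ip x y))\<^sup>2) = (of_real ((norm (ip y x))\<^sup>2) :: 'k)"
    unfolding mult_rc_cnj[symmetric] by (metis ip_commute mult.commute)
  then have "(norm (ip x y))\<^sup>2 = (norm (ip y x))\<^sup>2"
    by (simp only: of_real_eq_iff)
  then show ?thesis by simp
qed

text \<open>Supplies the Cauchy estimate for minimizing sequences. The identity is computed in
  \<open>'k\<close> and pulled back to the reals by injectivity of \<open>of_real\<close>.\<close>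

lemma parallelogram_law:
  fixes x y :: 'h
  shows "(norm (x + y))\<^sup>2 + (norm (x - y))\<^sup>2 = 2 * (norm x)\<^sup>2 + 2 * (norm y)\<^sup>2"
proof -
  have "ip (x + y) (x + y) + ip (x - y) (x - y) = 2 * ip x x + 2 * ip y y"
    by (simp add: ip_add_left ip_add_right ip_diff_left ip_diff_right)
  then have "of_real ((norm (x + y))\<^sup>2 + (norm (x - y))\<^sup>2) =
      (of_real (2 * (norm x)\<^sup>2 + 2 * (norm y)\<^sup>2) :: 'k)"
    unfolding ip_self by simp
  then show ?thesis
    by (simp only: of_real_eq_iff)
qed

text \<open>The subtracted multiple of \<open>w\<close> is the projection of \<open>x\<close> onto the line spanned by \<open>w\<close>.\<close>

lemma norm_diff_scale_square:
  assumes "w \<noteq> 0"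
  shows "(norm (x - scale (ip x w * of_real (1 / (norm w)\<^sup>2)) w))\<^sup>2 =
    (norm x)\<^sup>2 - (norm (ip x w))\<^sup>2 / (norm w)\<^sup>2"
proof -
  define t where "t = 1 / (norm w)\<^sup>2"
  define a where "a = ip x w"
  have t: "t * (norm w)\<^sup>2 = 1" using assms by (simp add: t_def)
  have aa: "a * rc_cnj a = of_real ((norm a)\<^sup>2)" by (rule mult_rc_cnj)
  have wx: "ip w x = rc_cnj a" unfolding a_def by (rule ip_commute)
  define c where "c = a * of_real t"
  have cc: "rc_cnj c = rc_cnj a * of_real t"
    by (simp add: c_def rc_cnj_mult rc_cnj_of_real)
  have "ip (x - scale c w) (x - scale c w) =
      ip x x - rc_cnj c * a - c * rc_cnj a + c * (rc_cnj c * ip w w)"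
    by (simp add: ip_diff_left ip_diff_right ip_scale_left ip_scale_right wx a_def algebra_simps)
  also have "\<dots> = ip x x - of_real t * (a * rc_cnj a) - of_real t * (a * rc_cnj a)
      + of_real t * (of_real t * ip w w) * (a * rc_cnj a)"
    unfolding cc by (simp add: c_def algebra_simps)
  also have "of_real t * ip w w = 1"
    unfolding ip_self using t by (metis of_real_1 of_real_mult)
  finally have "(of_real ((norm (x - scale c w))\<^sup>2) :: 'k) =
      of_real ((norm x)\<^sup>2 - t * (norm a)\<^sup>2)"
    unfolding ip_self aa by simp
  then show ?thesis
    by (simp only: of_real_eq_iff) (simp add: c_def a_def t_def)
qed

text \<open>The squared distance from \<open>x\<close> to the line spanned by \<open>y\<close> is
  nonnegative.\<close>

lemma Cauchy_Schwarz_ip: "norm (ip x y) \<le> norm x * norm y"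
proof (cases "y = 0")
  case True
  then show ?thesis using ip_diff_right[of x 0 0] by simp
next
  case False
  have "0 \<le> (norm x)\<^sup>2 - (norm (ip x y))\<^sup>2 / (norm y)\<^sup>2"
    using norm_diff_scale_square[OF False, of x] by (metis zero_le_power2)
  then have "(norm (ip x y))\<^sup>2 \<le> (norm x * norm y)\<^sup>2"
    using False by (simp add: field_simps power_mult_distrib)
  then show ?thesis
    by (simp add: power2_le_iff_abs_le)
qed

section \<open>Orthogonal projection onto closed subspaces\<close>

text \<open>A minimizing sequence is Cauchy by the parallelogram law; its limit exists by
  completeness and lies in \<open>W\<close> by closedness.\<close>

lemma closest_point_exists:
  assumes W: "subspace W" "closed W"
  obtains p where "p \<in> W" "\<And>w. w \<in> W \<Longrightarrow> norm (x - p) \<le> norm (x - w)"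
proof -
  define d where "d = (INF w\<in>W. norm (x - w))"
  have "W \<noteq> {}" using subspace_0[OF W(1)] by blast
  have bdd: "bdd_below ((\<lambda>w. norm (x - w)) ` W)"
    by (intro bdd_belowI2[of _ 0]) simp
  have d_le: "d \<le> norm (x - w)" if "w \<in> W" for w
    unfolding d_def using bdd that by (rule cINF_lower)
  have d0: "0 \<le> d"
    unfolding d_def using \<open>W \<noteq> {}\<close> by (intro cINF_greatest) auto
  have "\<exists>w\<in>W. norm (x - w) < d + 1 / real (Suc n)" for n
    using cINF_less_iff[OF \<open>W \<noteq> {}\<close> bdd, of "d + 1 / real (Suc n)"] by (simp add: d_def)
  then obtain u where u: "\<And>n. u n \<in> W" "\<And>n. norm (x - u n) < d + 1 / real (Suc n)"
    by metis
  have lim: "(\<lambda>n. norm (x - u n)) \<longlonglongrightarrow> d"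
  proof (rule tendsto_sandwich)
    show "\<forall>\<^sub>F n in sequentially. d \<le> norm (x - u n)"
      using d_le u(1) by simp
    show "\<forall>\<^sub>F n in sequentially. norm (x - u n) \<le> d + 1 / real (Suc n)"
      using u(2) by (intro always_eventually allI less_imp_le)
    show "(\<lambda>n. d + 1 / real (Suc n)) \<longlonglongrightarrow> d"
      using tendsto_add[OF tendsto_const LIMSEQ_Suc[OF lim_1_over_n]] by simp
  qed simp
  \<comment> \<open>the midpoint of two points of \<open>W\<close> is no closer to \<open>x\<close> than \<open>d\<close>\<close>
  have sep: "(norm (y - z))\<^sup>2 \<le> 2 * ((norm (x - y))\<^sup>2 - d\<^sup>2) + 2 * ((norm (x - z))\<^sup>2 - d\<^sup>2)"
    if "y \<in> W" "z \<in> W" for y z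
  proof -
    have "(1/2) *\<^sub>R (y + z) \<in> W"
      unfolding scale_of_real[symmetric] using W(1) that by (intro subspace_scale subspace_add)
    then have "d \<le> norm (x - (1/2) *\<^sub>R (y + z))" by (rule d_le)
    also have "x - (1/2) *\<^sub>R (y + z) = (1/2) *\<^sub>R ((x - y) + (x - z))"
      by (simp add: algebra_simps flip: scaleR_add_left)
    finally have "2 * d \<le> norm ((x - y) + (x - z))" by simp
    then have "(2 * d)\<^sup>2 \<le> (norm ((x - y) + (x - z)))\<^sup>2"
      using d0 by (intro power_mono) auto
    moreover have "(norm ((x - y) - (x - z)))\<^sup>2 = (norm (y - z))\<^sup>2"
      by (simp add: norm_minus_commute)
    ultimately show ?thesis
      using parallelogram_law[of "x - y" "x - z"] by (simp add: power_mult_distrib)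
  qed
  have "Cauchy u"
  proof (rule metric_CauchyI)
    fix e :: real
    assume "e > 0"
    have "(\<lambda>n. 2 * ((norm (x - u n))\<^sup>2 - d\<^sup>2)) \<longlonglongrightarrow> 2 * (d\<^sup>2 - d\<^sup>2)"
      by (intro tendsto_intros lim)
    \<comment> \<open>Two such terms occur in \<open>sep\<close>, so half of
      \<open>e\<^sup>2\<close> is allotted to each.\<close>
    then have "\<forall>\<^sub>F n in sequentially. 2 * ((norm (x - u n))\<^sup>2 - d\<^sup>2) < e\<^sup>2 / 2"
      using \<open>e > 0\<close> by (intro order_tendstoD(2)) auto
    then obtain M where M: "\<And>n. n \<ge> M \<Longrightarrow> 2 * ((norm (x - u n))\<^sup>2 - d\<^sup>2) < e\<^sup>2 / 2"
      by (auto simp: eventually_sequentially)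
    have "dist (u m) (u n) < e" if "m \<ge> M" "n \<ge> M" for m n
    proof -
      have "(norm (u m - u n))\<^sup>2 < e\<^sup>2"
        using sep[OF u(1) u(1), of m n] M[OF that(1)] M[OF that(2)] by linarith
      then show ?thesis
        using \<open>e > 0\<close> by (simp add: dist_norm power_less_imp_less_base)
    qed
    then show "\<exists>M. \<forall>m\<ge>M. \<forall>n\<ge>M. dist (u m) (u n) < e" by blast
  qed
  then obtain p where p: "u \<longlonglongrightarrow> p"
    using Cauchy_convergent convergent_def by blast
  have "p \<in> W"
    using closed_sequentially[OF W(2) u(1) p] .
  moreover have "norm (x - p) = d"
    using LIMSEQ_unique[OF tendsto_norm[OF tendsto_diff[OF tendsto_const p]] lim] .
  ultimately show thesis
    using that d_le by metis
qed

text \<open>Justifies the \<open>THE\<close> in the definition: the closest point is the only point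
  of \<open>W\<close> whose residual is orthogonal to \<open>W\<close>.\<close>

lemma orth_proj:
  assumes W: "subspace W" "closed W"
  shows "orth_proj W x \<in> W" "w \<in> W \<Longrightarrow> ip (x - orth_proj W x) w = 0"
proof -
  obtain p where p: "p \<in> W" "\<And>w. w \<in> W \<Longrightarrow> norm (x - p) \<le> norm (x - w)"
    using closest_point_exists[OF W] by blast
  have orth: "ip (x - p) w = 0" if "w \<in> W" for w
  proof (cases "w = 0")
    case True
    then show ?thesis using ip_diff_right[of "x - p" 0 0] by simp
  next
    case False
    \<comment> \<open>Moving \<open>p\<close> by the component of the residual along
      \<open>w\<close> would lower the squared distance by
      \<open>(norm (ip (x - p) w))\<^sup>2 / (norm w)\<^sup>2\<close>; minimality forces this to
      vanish.\<close>
    define c where "c = ip (x - p) w * of_real (1 / (norm w)\<^sup>2)"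
    have "p + scale c w \<in> W"
      using W(1) p(1) that by (intro subspace_add subspace_scale)
    then have "norm (x - p) \<le> norm (x - p - scale c w)"
      using p(2) by (metis diff_diff_eq)
    then have "(norm (x - p))\<^sup>2 \<le> (norm (x - p - scale c w))\<^sup>2"
      by (intro power_mono) auto
    also have "\<dots> = (norm (x - p))\<^sup>2 - (norm (ip (x - p) w))\<^sup>2 / (norm w)\<^sup>2"
      unfolding c_def by (rule norm_diff_scale_square[OF False])
    finally have "(norm (ip (x - p) w))\<^sup>2 \<le> 0"
      using False by (simp add: divide_le_0_iff)
    then show ?thesis by simp
  qed
  have "\<exists>!p. p \<in> W \<and> (\<forall>w\<in>W. ip (x - p) w = 0)"
  proof (rule ex1I[of _ p])
    fix q
    assume q: "q \<in> W \<and> (\<forall>w\<in>W. ip (x - q) w = 0)"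
    \<comment> \<open>Both residuals are orthogonal to \<open>p - q\<close>, hence so is their
      difference, which is \<open>p - q\<close> itself.\<close>
    have "p - q \<in> W" using W(1) p(1) q by (intro subspace_diff) auto
    then have "ip (x - q) (p - q) - ip (x - p) (p - q) = 0"
      using q orth by simp
    then have "ip (p - q) (p - q) = 0"
      by (simp flip: ip_diff_left)
    then show "q = p" by (simp add: ip_self)
  qed (use p orth in auto)
  from theI'[OF this] show "orth_proj W x \<in> W" "w \<in> W \<Longrightarrow> ip (x - orth_proj W x) w = 0"
    unfolding orth_proj_def by auto
qed

text \<open>Lets a vector of \<open>W\<close> see only the projection of \<open>x\<close>, the
  quantity that the frame bound controls.\<close>

lemma ip_orth_proj_right:
  assumes "subspace W" "closed W" "w \<in> W"
  shows "ip w (orth_proj W x) = ip w x"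
proof -
  have "ip w (x - orth_proj W x) = 0"
    using norm_ip_commute[of w "x - orth_proj W x"] orth_proj(2)[OF assms] by simp
  then show ?thesis by (simp add: ip_diff_right)
qed

section \<open>Boundedness and convergence of synthesis\<close>

text \<open>Cauchy-Schwarz enters twice: in the Hilbert space for each \<open>i\<close>, then for
  the sum over \<open>F\<close>.\<close>

lemma norm_synthesis_square_le:
  assumes sub: "\<And>i. i \<in> F \<Longrightarrow> subspace (W i) \<and> closed (W i)"
    and bound: "\<And>x. (\<Sum>i\<in>F. (v i)\<^sup>2 * (norm (orth_proj (W i) x))\<^sup>2) \<le> B * (norm x)\<^sup>2"
    and B: "0 \<le> B"
    and f: "\<And>i. i \<in> F \<Longrightarrow> f i \<in> W i"
  shows "(norm (\<Sum>i\<in>F. v i *\<^sub>R f i))\<^sup>2 \<le> B * (\<Sum>i\<in>F. (norm (f i))\<^sup>2)"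
proof -
  define y where "y = (\<Sum>i\<in>F. v i *\<^sub>R f i)"
  define S where "S = (\<Sum>i\<in>F. (norm (f i))\<^sup>2)"
  have "(norm y)\<^sup>2 = norm (ip y y)"
    by (simp add: ip_self norm_power)
  also have "ip y y = (\<Sum>i\<in>F. of_real (v i) * ip (f i) (orth_proj (W i) y))"
    unfolding y_def ip_sum_left ip_scaleR_left
    using sub f by (intro sum.cong) (auto simp: ip_orth_proj_right)
  also have "norm \<dots> \<le> (\<Sum>i\<in>F. \<bar>norm (f i)\<bar> * \<bar>v i * norm (orth_proj (W i) y)\<bar>)"
  proof (intro sum_norm_le)
    fix i
    show "norm (of_real (v i) * ip (f i) (orth_proj (W i) y)) \<le>
        \<bar>norm (f i)\<bar> * \<bar>v i * norm (orth_proj (W i) y)\<bar>"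
      using mult_left_mono[OF Cauchy_Schwarz_ip, of "\<bar>v i\<bar>" "f i" "orth_proj (W i) y"]
      by (simp add: norm_mult abs_mult mult_ac)
  qed
  also have "\<dots> \<le> L2_set (\<lambda>i. norm (f i)) F * L2_set (\<lambda>i. v i * norm (orth_proj (W i) y)) F"
    by (rule L2_set_mult_ineq)
  \<comment> \<open>Squaring once more removes the square roots inside
    \<open>L2_set\<close>.\<close>
  finally have "((norm y)\<^sup>2)\<^sup>2 \<le>
      (L2_set (\<lambda>i. norm (f i)) F * L2_set (\<lambda>i. v i * norm (orth_proj (W i) y)) F)\<^sup>2"
    by (intro power_mono) auto
  also have "\<dots> = S * (\<Sum>i\<in>F. (v i)\<^sup>2 * (norm (orth_proj (W i) y))\<^sup>2)"
    by (simp add: L2_set_def S_def power_mult_distrib sum_nonneg)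
  also have "\<dots> \<le> S * (B * (norm y)\<^sup>2)"
    by (intro mult_left_mono bound) (simp add: S_def sum_nonneg)
  finally have le: "(norm y)\<^sup>2 * (norm y)\<^sup>2 \<le> (B * S) * (norm y)\<^sup>2"
    by (simp add: power2_eq_square mult_ac)
  show ?thesis
  \<comment> \<open>A factor \<open>(norm y)\<^sup>2\<close> stands on both sides of
    \<open>le\<close> and cancels unless \<open>y = 0\<close>.\<close>
  proof (cases "y = 0")
    case True
    then show ?thesis
      using B by (simp add: sum_nonneg flip: y_def)
  next
    case False
    then have "(norm y)\<^sup>2 \<le> B * S"
      using le by (simp only: mult_le_cancel_right) auto
    then show ?thesis
      by (simp only: y_def S_def)
  qed
qed

lemma fusion_frame_summable_on:
  assumes "fusion_frame I W v" "f \<in> l2_sum I W"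
  shows "(\<lambda>i. v i *\<^sub>R f i) summable_on I"
proof -
  from assms(1) obtain A B where AB: "0 < A" "A \<le> B"
    and sub: "\<And>i. i \<in> I \<Longrightarrow> subspace (W i) \<and> closed (W i)"
    and summable: "\<And>x. (\<lambda>i. (v i)\<^sup>2 * (norm (orth_proj (W i) x))\<^sup>2) summable_on I"
    and bound: "\<And>x. (\<Sum>\<^sub>\<infinity>i\<in>I. (v i)\<^sup>2 * (norm (orth_proj (W i) x))\<^sup>2) \<le> B * (norm x)\<^sup>2"
    unfolding fusion_frame_def by blast
  from assms(2) have f: "\<And>i. i \<in> I \<Longrightarrow> f i \<in> W i" "(\<lambda>i. (norm (f i))\<^sup>2) summable_on I"
    by (auto simp: l2_sum_def families_def)
  show ?thesis
  proof (rule summable_on_norm_sum_square_le)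
    show "(\<lambda>i. B * (norm (f i))\<^sup>2) summable_on I"
      using f(2) by (rule summable_on_cmult_right)
    fix F
    assume F: "finite F" "F \<subseteq> I"
    \<comment> \<open>The terms are nonnegative, so the upper frame bound passes to finite
      subsums.\<close>
    have "(\<Sum>i\<in>F. (v i)\<^sup>2 * (norm (orth_proj (W i) x))\<^sup>2) \<le> B * (norm x)\<^sup>2" for x
      using finite_sum_le_infsum[OF summable F, of x] bound[of x] by simp
    then have "(norm (\<Sum>i\<in>F. v i *\<^sub>R f i))\<^sup>2 \<le> B * (\<Sum>i\<in>F. (norm (f i))\<^sup>2)"
      using F AB sub f(1) by (intro norm_synthesis_square_le[where W = W]) auto
    then show "(norm (\<Sum>i\<in>F. v i *\<^sub>R f i))\<^sup>2 \<le> (\<Sum>i\<in>F. B * (norm (f i))\<^sup>2)"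
      by (simp add: sum_distrib_left)
  qed
qed

section \<open>Triviality of the kernel and the excess\<close>

lemma riesz_decomposition_synthesis_kernel:
  assumes "riesz_decomposition I W v"
  shows "synthesis_kernel I W v = {0}"
proof -
  from assms have frame: "fusion_frame I W v"
    and unique: "\<And>f g x. f \<in> families I W \<Longrightarrow> (f has_sum x) I \<Longrightarrow>
      g \<in> families I W \<Longrightarrow> (g has_sum x) I \<Longrightarrow> f = g"
    unfolding riesz_decomposition_def by blast+
  from frame have sub: "\<And>i. i \<in> I \<Longrightarrow> subspace (W i)" and pos: "\<And>i. i \<in> I \<Longrightarrow> v i > 0"
    unfolding fusion_frame_def by auto
  have zero: "0 \<in> families I W"
    using sub by (auto simp: families_def subspace_0)
  have "f = 0" if f: "f \<in> synthesis_kernel I W v" for f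
  proof -
    from f have l2: "f \<in> l2_sum I W" and ker: "(\<Sum>\<^sub>\<infinity>i\<in>I. v i *\<^sub>R f i) = 0"
      by (auto simp: synthesis_kernel_def synthesis_def)
    then have fam: "f \<in> families I W" by (simp add: l2_sum_def)
    \<comment> \<open>\<open>infsum\<close> defaults to \<open>0\<close> on families that are not
      summable, so \<open>ker\<close> becomes a representation of \<open>0\<close> only through
      summability.\<close>
    have "((\<lambda>i. v i *\<^sub>R f i) has_sum 0) I"
      using has_sum_infsum[OF fusion_frame_summable_on[OF frame l2]] ker by simp
    moreover have "(\<lambda>i. v i *\<^sub>R f i) \<in> families I W"
      using fam sub by (auto simp: families_def subspace_scale simp flip: scale_of_real)
    moreover have "(0 has_sum 0) I"
      by (rule has_sum_0) simp
    ultimately have "(\<lambda>i. v i *\<^sub>R f i) = 0"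
      using unique zero by blast
    \<comment> \<open>Positive weights cancel on \<open>I\<close>; outside \<open>I\<close> the
      family vanishes by its encoding.\<close>
    then have "f i = 0" if "i \<in> I" for i
      using pos[OF that] by (metis less_irrefl scaleR_eq_0_iff zero_fun_apply)
    then show "f = 0"
      using fam by (auto simp: families_def fun_eq_iff)
  qed
  moreover have "0 \<in> synthesis_kernel I W v"
    using zero by (simp add: synthesis_kernel_def synthesis_def l2_sum_def)
  ultimately show ?thesis by blast
qed

end

theorem corollary5p6:
  fixes scale :: "'k::rc_field \<Rightarrow> 'h::banach \<Rightarrow> 'h"
    and ip :: "'h \<Rightarrow> 'h \<Rightarrow> 'k"
    and I :: "'i set" and W :: "'i \<Rightarrow> 'h set" and v :: "'i \<Rightarrow> real"
  assumes "hilbert_space scale ip"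
    and "hilbert_space.riesz_decomposition scale ip I W v"
  shows "hilbert_space.excess scale I W v = 0"
proof -
  interpret hilbert_space scale ip by fact
  show ?thesis
    \<comment> \<open>The dimension is taken in the space of families with pointwise
      scaling.\<close>
    using vector_space.edim_zero[OF vector_space_families]
    by (simp add: excess_def riesz_decomposition_synthesis_kernel[OF assms(2)])
qed

end
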